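(* Let $H_n$ denote the (physicist) Hermite polynomial of degree $n\in\mathbb{N}_0$. For $x\in\mathbb{R}$, $$\lim_{N\to\infty}\sqrt{N}\sum_{n=N+1}^\infty\frac{(H_n(x))^2}{2n\,2^n n!\sqrt{\pi}}=\frac{\exp(x^2)}{\sqrt{2}\,\pi},$$ and, for $x,y\in\mathbb{R}$ with $x\neq y$ and for all $\gamma<1$, $$\lim_{N\to\infty}N^\gamma\sum_{n=N+1}^\infty\frac{H_n(x)H_n(y)}{2n\,2^n n!\sqrt{\pi}}=0.$$
   Context: The Hermite polynomials $\{H_n:n\in\mathbb{N}_0\}$ are the polynomials, with $H_n$ of degree $n$, which are orthogonal on $\mathbb{R}$ with respect to the weight $\exp(-x^2)$ and normalised so that $\int_{-\infty}^\infty e^{-x^2}(H_n(x))^2\,\mathrm{d}x=2^n n!\sqrt{\pi}$ and the leading coefficient of $H_n$ is $2^n$. They satisfy $(e^{-x^2}H_n'(x))'=-2n\,e^{-x^2}H_n(x)$. *)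

theory Defs
  imports "HOL-Probability.Probability" "HOL-Computational_Algebra.Polynomial"
begin

definition hermite_family :: "(nat \<Rightarrow> real poly) \<Rightarrow> bool" where
  "hermite_family H \<longleftrightarrow>
     (\<forall>n. degree (H n) = n \<and> lead_coeff (H n) = 2 ^ n) \<and>
     (\<forall>m n. m \<noteq> n \<longrightarrow>
        has_bochner_integral lborel (\<lambda>x. exp (- x\<^sup>2) * (poly (H m) x * poly (H n) x)) 0) \<and>
     (\<forall>n. has_bochner_integral lborel (\<lambda>x. exp (- x\<^sup>2) * (poly (H n) x)\<^sup>2)
            (2 ^ n * fact n * sqrt pi))"

text \<open>
  The conditions above are satisfiable: we check that the polynomials given by
  \<open>H\<^sub>0 = 1\<close>, \<open>H\<^sub>n\<^sub>+\<^sub>1 = 2x H\<^sub>n - H\<^sub>n'\<close> meet them.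
\<close>

primrec hermite_rec :: "nat \<Rightarrow> real poly" where
  "hermite_rec 0 = 1"
| "hermite_rec (Suc n) = [:0, 2:] * hermite_rec n - pderiv (hermite_rec n)"

lemma hermite_rec_degree_coeff:
  "degree (hermite_rec n) = n \<and> coeff (hermite_rec n) n = 2 ^ n"
proof (induction n)
  case (Suc n)
  let ?h = "hermite_rec n"
  have deg: "degree ?h = n" and lc: "coeff ?h n = 2 ^ n" using Suc by auto
  have c: "coeff (hermite_rec (Suc n)) (Suc n) = 2 ^ Suc n"
    using lc by (simp add: coeff_pderiv coeff_eq_0 deg)
  have "degree (hermite_rec (Suc n)) \<le> Suc n"
  proof (rule degree_le, intro allI impI)
    fix i assume "Suc n < i"
    then show "coeff (hermite_rec (Suc n)) i = 0"
      by (cases i) (auto simp: coeff_pderiv coeff_eq_0 deg)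
  qed
  moreover have "Suc n \<le> degree (hermite_rec (Suc n))"
    by (rule le_degree) (simp only: c, simp)
  ultimately show ?case using c by (metis le_antisym)
qed simp

lemma gaussian_monomial_even:
  "has_bochner_integral lborel (\<lambda>x::real. exp (- x\<^sup>2) * x ^ (2 * k))
     (sqrt pi * (fact (2 * k) / (2 ^ (2 * k) * fact k)))"
  using has_bochner_integral_even_function[OF gaussian_moment_even_pos[where k = k]] by simp

lemma gaussian_monomial_odd:
  "has_bochner_integral lborel (\<lambda>x::real. exp (- x\<^sup>2) * x ^ (2 * k + 1)) 0"
  using gaussian_moment_odd_pos by (rule has_bochner_integral_odd_function) simp

lemma integrable_gaussian_monomial:
  "integrable lborel (\<lambda>x::real. exp (- x\<^sup>2) * x ^ k)"
  using gaussian_monomial_even[of "k div 2"] gaussian_monomial_odd[of "k div 2"]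
  by (cases "even k") (auto simp: integrable.simps elim!: evenE oddE)

lemma integrable_gaussian_poly:
  fixes p :: "real poly"
  shows "integrable lborel (\<lambda>x. exp (- x\<^sup>2) * poly p x)"
proof -
  have "(\<lambda>x. exp (- x\<^sup>2) * poly p x) =
        (\<lambda>x. \<Sum>i\<le>degree p. coeff p i * (exp (- x\<^sup>2) * x ^ i))"
    by (auto simp: poly_altdef sum_distrib_left mult_ac intro!: sum.cong)
  then show ?thesis
    by (simp only:) (intro Bochner_Integration.integrable_sum integrable_mult_right
        integrable_gaussian_monomial)
qed

definition gauss_int :: "real poly \<Rightarrow> real" where
  "gauss_int p = (LINT x|lborel. exp (- x\<^sup>2) * poly p x)"

lemma gauss_int_add: "gauss_int (p + q) = gauss_int p + gauss_int q"
  by (simp add: gauss_int_def ring_distribs integrable_gaussian_poly)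

lemma gauss_int_diff: "gauss_int (p - q) = gauss_int p - gauss_int q"
  by (simp add: gauss_int_def ring_distribs integrable_gaussian_poly)

lemma gauss_int_smult: "gauss_int (smult c p) = c * gauss_int p"
  by (simp add: gauss_int_def mult.left_commute)

lemma gauss_int_sum: "finite A \<Longrightarrow> gauss_int (\<Sum>i\<in>A. f i) = (\<Sum>i\<in>A. gauss_int (f i))"
  by (induction A rule: finite_induct) (simp_all add: gauss_int_add, simp add: gauss_int_def)

lemma gauss_int_monom_even:
  "gauss_int (monom 1 (2 * k)) = sqrt pi * (fact (2 * k) / (2 ^ (2 * k) * fact k))"
  using has_bochner_integral_integral_eq[OF gaussian_monomial_even[of k]]
  by (simp add: gauss_int_def poly_monom)

lemma gauss_int_monom_odd: "gauss_int (monom 1 (2 * k + 1)) = 0"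
  using has_bochner_integral_integral_eq[OF gaussian_monomial_odd[of k]]
  by (simp add: gauss_int_def poly_monom)

lemma gauss_int_monom_step:
  "2 * gauss_int (monom 1 (Suc i)) = real i * gauss_int (monom 1 (i - 1))"
proof (cases "even i")
  case True
  then obtain k where k: "i = 2 * k" by (auto elim: evenE)
  show ?thesis
  proof (cases k)
    case 0
    then show ?thesis using gauss_int_monom_odd[of 0] k by simp
  next
    case (Suc j)
    then show ?thesis
      using gauss_int_monom_odd[of k] gauss_int_monom_odd[of j] k by simp
  qed
next
  case False
  then obtain k where k: "i = 2 * k + 1" by (auto elim: oddE)
  have "gauss_int (monom 1 (2 * Suc k)) = (2 * real k + 1) / 2 * gauss_int (monom 1 (2 * k))"
    unfolding gauss_int_monom_even by (simp add: divide_simps) (simp add: algebra_simps)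
  then have "2 * gauss_int (monom 1 (2 * Suc k)) = (2 * real k + 1) * gauss_int (monom 1 (2 * k))"
    by (simp only:)
  then show ?thesis
    using k by (simp add: add.commute)
qed

lemma gauss_int_by_parts: "gauss_int ([:0, 2:] * q - pderiv q) = 0"
proof -
  have mon: "gauss_int ([:0, 2:] * monom c i - pderiv (monom c i)) = 0" for c i
  proof -
    have eq: "[:0, 2:] * monom c i - pderiv (monom c i) =
          smult (2 * c) (monom 1 (Suc i)) - smult (c * real i) (monom 1 (i - 1))"
      by (simp add: pderiv_monom smult_monom monom_Suc mult_ac)
    show ?thesis
      unfolding eq gauss_int_diff gauss_int_smult
      using gauss_int_monom_step[of i] by (simp add: mult_ac)
  qed
  have "[:0, 2:] * q - pderiv q =
        (\<Sum>i\<le>degree q. [:0, 2:] * monom (coeff q i) i - pderiv (monom (coeff q i) i))"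
    using higher_pderiv_sum[of 1 "\<lambda>i. monom (coeff q i) i" "{..degree q}"]
    by (simp add: sum_subtractf sum_distrib_left[symmetric] poly_as_sum_of_monoms
        del: mult_pCons_left)
  then show ?thesis
    by (simp only: gauss_int_sum finite_atMost mon) simp
qed

lemma gauss_int_hermite_rec:
  "gauss_int (hermite_rec n * p) = gauss_int ((pderiv ^^ n) p)"
proof (induction n arbitrary: p)
  case (Suc n)
  let ?h = "hermite_rec n"
  have "hermite_rec (Suc n) * p = ([:0, 2:] * (?h * p) - pderiv (?h * p)) + ?h * pderiv p"
    by (simp add: pderiv_mult algebra_simps)
  then have "gauss_int (hermite_rec (Suc n) * p) = gauss_int (?h * pderiv p)"
    by (simp only: gauss_int_add gauss_int_by_parts add_0_left)
  then show ?case by (simp only: Suc.IH funpow_Suc_right o_def)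
qed simp

lemma gauss_int_hermite_rec_low:
  assumes "degree p \<le> n"
  shows "gauss_int (hermite_rec n * p) = fact n * coeff p n * sqrt pi"
proof -
  have "(pderiv ^^ n) p = smult (fact n * coeff p n) (monom 1 0)"
  proof (rule poly_eqI)
    fix i
    show "coeff ((pderiv ^^ n) p) i = coeff (smult (fact n * coeff p n) (monom 1 0)) i"
      using assms
      by (cases i) (simp_all add: coeff_higher_pderiv coeff_eq_0 pochhammer_fact[symmetric])
  qed
  then show ?thesis
    using gauss_int_monom_even[of 0] by (simp only: gauss_int_hermite_rec gauss_int_smult) simp
qed

lemma hermite_family_exists: "hermite_family hermite_rec"
proof -
  have hb: "has_bochner_integral lborel (\<lambda>x. exp (- x\<^sup>2) * (poly p x * poly q x))
              (gauss_int (p * q))" for p q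
    using has_bochner_integral_integrable[OF integrable_gaussian_poly[of "p * q"]]
    by (simp add: gauss_int_def)
  have lt: "gauss_int (hermite_rec n * hermite_rec m) = 0" if "m < n" for m n
    using gauss_int_hermite_rec_low[of "hermite_rec m" n] hermite_rec_degree_coeff[of m] that
    by (simp add: coeff_eq_0)
  have ne: "gauss_int (hermite_rec m * hermite_rec n) = 0" if "m \<noteq> n" for m n
    using lt[of m n] lt[of n m] that by (cases "m < n") (auto simp: mult.commute)
  have same: "gauss_int (hermite_rec n * hermite_rec n) = 2 ^ n * fact n * sqrt pi" for n
    using gauss_int_hermite_rec_low[of "hermite_rec n" n] hermite_rec_degree_coeff[of n] by simp
  have "has_bochner_integral lborel
          (\<lambda>x. exp (- x\<^sup>2) * (poly (hermite_rec m) x * poly (hermite_rec n) x)) 0"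
    if "m \<noteq> n" for m n
    using hb[of "hermite_rec m" "hermite_rec n"] ne[OF that] by simp
  moreover have "has_bochner_integral lborel (\<lambda>x. exp (- x\<^sup>2) * (poly (hermite_rec n) x)\<^sup>2)
                   (2 ^ n * fact n * sqrt pi)" for n
    using hb[of "hermite_rec n" "hermite_rec n"] same[of n]
    by (simp add: power2_eq_square[of "poly _ _"])
  ultimately show ?thesis
    unfolding hermite_family_def by (simp add: hermite_rec_degree_coeff)
qed

end

theory Submission
  imports Defs "HOL-Real_Asymp.Real_Asymp"
begin

text \<open>
  Write \<open>c\<^sub>n = 2\<^sup>n n! \<surd>\<pi>\<close> and \<open>w\<^sub>n(x) = H\<^sub>n(x)\<^sup>2 / c\<^sub>n\<close>. For fixed \<open>x\<close>, \<open>w\<^sub>n(x)\<close> has size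
  \<open>n\<^bsup>-1/2\<^esup>\<close> and oscillates with \<open>n\<close>, like a squared cosine whose phase advances by about a quarter
  period from one \<open>n\<close> to the next; the sum of two neighbours does not oscillate, as
  \<open>cos\<^sup>2 + sin\<^sup>2 = 1\<close>. The proof makes this precise without asymptotics of \<open>H\<^sub>n\<close> itself.

  The Hermite function \<open>u = exp (-x\<^sup>2/2) H\<^sub>n\<close> solves \<open>u'' + (2n + 1 - x\<^sup>2) u = 0\<close>, so its energy
  \<open>u'\<^sup>2 + (2n + 1 - x\<^sup>2) u\<^sup>2\<close> has derivative \<open>-2x u\<^sup>2\<close>, which is a fraction \<open>O(1/n)\<close> of the energy.
  Between \<open>0\<close> and \<open>x\<close> the energy therefore changes by a factor \<open>1 + O(1/n)\<close> only
  (\<open>hermite_energy_le_0\<close>, \<open>hermite_energy_ge_0\<close>). At \<open>0\<close> it is given by central binomial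
  coefficients, hence by the Wallis product (\<open>hermite_energy_0_asymp\<close>). At \<open>x\<close>, since
  \<open>H\<^sub>n' = 2n H\<^sub>n\<^sub>-\<^sub>1\<close>, the energy divided by \<open>c\<^sub>n\<close> is \<open>2n exp (-x\<^sup>2) (w\<^sub>n\<^sub>-\<^sub>1(x) + w\<^sub>n(x))\<close> up to lower order
  (\<open>hermite_pair_near_energy\<close>). Together,
  \<open>\<surd>(n+1) (w\<^sub>n(x) + w\<^sub>n\<^sub>+\<^sub>1(x)) \<longlonglongrightarrow> exp (x\<^sup>2) \<surd>2 / \<pi>\<close> (\<open>hermite_pair_asymp\<close>).

  On the diagonal, replacing each \<open>w\<^sub>n\<close> by the mean of two neighbours costs a telescoping
  term, and \<open>tail_sum_asymp\<close> compares what remains with the differences of \<open>1/\<surd>n\<close>.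
  Off the diagonal, the Christoffel--Darboux identity makes \<open>(x - y) H\<^sub>n(x) H\<^sub>n(y) / c\<^sub>n\<close> a difference
  of consecutive brackets. These are bounded in \<open>n\<close> because \<open>w\<^sub>n = O(n\<^bsup>-1/2\<^esup>)\<close>, so summation
  by parts bounds the tail by a multiple of \<open>1/(N+1)\<close>, which beats \<open>N\<^sup>\<gamma>\<close> for every \<open>\<gamma> < 1\<close>.
\<close>

section \<open>Orthogonality determines the Hermite polynomials\<close>

lemma gauss_int_mult_hermite_family:
  assumes "hermite_family H" and "m \<noteq> n"
  shows "gauss_int (H m * H n) = 0"
proof -
  have "has_bochner_integral lborel (\<lambda>x. exp (- x\<^sup>2) * (poly (H m) x * poly (H n) x)) 0"
    using assms unfolding hermite_family_def by blast
  then show ?thesis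
    by (auto simp: gauss_int_def dest: has_bochner_integral_integral_eq)
qed

text \<open>
  A polynomial of degree less than \<open>n\<close> is a combination of \<open>H\<^sub>0, \<dots>, H\<^sub>n\<^sub>-\<^sub>1\<close>: subtract a multiple of
  \<open>H\<^sub>n\<^sub>-\<^sub>1\<close> to kill the top coefficient and induct. Vanishing coefficients, rather than a bound
  on the degree, also cover the zero polynomial at \<open>n = 0\<close>.
\<close>

lemma gauss_int_orthogonal_lower_degree:
  fixes H :: "nat \<Rightarrow> real poly" and p q :: "real poly"
  assumes deg: "\<And>m. degree (H m) = m" and lead: "\<And>m. coeff (H m) m = 2 ^ m"
    and orth: "\<And>m. m < n \<Longrightarrow> gauss_int (q * H m) = 0"
    and coeffs: "\<And>i. n \<le> i \<Longrightarrow> coeff p i = 0"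
  shows "gauss_int (q * p) = 0"
  using orth coeffs
proof (induction n arbitrary: p)
  case 0
  then have "p = 0" by (auto intro: poly_eqI)
  then show ?case by (simp add: gauss_int_def)
next
  case (Suc n)
  define c where "c = coeff p n / 2 ^ n"
  have "coeff (p - smult c (H n)) i = 0" if "n \<le> i" for i
    using that Suc.prems(2)[of i] deg[of n] lead[of n] coeff_eq_0[of "H n" i]
    by (cases "i = n") (auto simp: c_def)
  then have "gauss_int (q * (p - smult c (H n))) = 0"
    using Suc.IH[of "p - smult c (H n)"] Suc.prems(1) by simp
  then show ?case
    using Suc.prems(1)[of n] by (simp add: algebra_simps gauss_int_diff gauss_int_smult)
qed

text \<open>
  The difference \<open>D\<close> of two candidates for \<open>H\<^sub>n\<close> has degree \<open>k < n\<close>, since their leading terms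
  agree. Both candidates are orthogonal to \<open>hermite_rec k\<close>, hence so is \<open>D\<close>; but the inner product
  of \<open>D\<close> with \<open>hermite_rec k\<close> is a nonzero multiple of the leading coefficient of \<open>D\<close>.
\<close>

lemma hermite_family_unique:
  assumes H: "hermite_family H"
  shows "H n = hermite_rec n"
proof (rule ccontr)
  assume ne: "H n \<noteq> hermite_rec n"
  define D where "D = H n - hermite_rec n"
  define k where "k = degree D"
  have deg: "degree (H m) = m" and "lead_coeff (H m) = 2 ^ m" for m
    using H unfolding hermite_family_def by blast+
  then have lead: "coeff (H m) m = 2 ^ m" for m
    by metis
  note deg' = hermite_rec_degree_coeff
  have D0: "D \<noteq> 0" using ne by (simp add: D_def)
  have high: "coeff D i = 0" if "n \<le> i" for i
    using that deg[of n] lead[of n] deg'[of n] coeff_eq_0[of "H n" i] coeff_eq_0[of "hermite_rec n" i]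
    by (cases "i = n") (auto simp: D_def)
  have kn: "k < n"
    using high[of k] D0 unfolding k_def by (metis leading_coeff_0_iff not_le)
  have low: "coeff (hermite_rec k) i = 0" if "n \<le> i" for i
    using that kn deg'[of k] by (intro coeff_eq_0) simp
  have "gauss_int (H n * hermite_rec k) = 0"
    by (rule gauss_int_orthogonal_lower_degree[where H = H and n = n])
       (use deg lead low gauss_int_mult_hermite_family[OF H] in auto)
  moreover have "gauss_int (hermite_rec n * hermite_rec k) = 0"
    using gauss_int_hermite_rec_low[of "hermite_rec k" n] low[of n] kn deg'[of k] by simp
  ultimately have "gauss_int (hermite_rec k * D) = 0"
    by (simp add: D_def right_diff_distrib gauss_int_diff mult.commute)
  then have "coeff D k = 0"
    using gauss_int_hermite_rec_low[of D k] by (simp add: k_def)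
  then show False using D0 by (simp add: k_def)
qed

section \<open>Derivatives and normalisation\<close>

lemma pderiv_hermite_rec_Suc:
  "pderiv (hermite_rec (Suc n)) = smult (2 * real (Suc n)) (hermite_rec n)"
proof (induction n)
  case 0
  show ?case by (simp add: pderiv_pCons)
next
  case (Suc n)
  let ?h = "hermite_rec (Suc n)"
  have "pderiv (hermite_rec (Suc (Suc n))) = pderiv ([:0, 2:] * ?h - pderiv ?h)"
    by (simp only: hermite_rec.simps)
  also have "\<dots> = smult 2 ?h + [:0, 2:] * pderiv ?h - pderiv (pderiv ?h)"
    by (simp add: pderiv_mult pderiv_diff pderiv_pCons pderiv_smult del: hermite_rec.simps)
  also have "\<dots> = smult 2 ?h + smult (2 * real (Suc n))
                    ([:0, 2:] * hermite_rec n - pderiv (hermite_rec n))"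
    by (simp add: Suc.IH pderiv_smult smult_diff_right algebra_simps del: hermite_rec.simps)
  also have "\<dots> = smult (2 * real (Suc (Suc n))) ?h"
    by (simp only: hermite_rec.simps(2)[symmetric] smult_add_left[symmetric])
       (simp add: algebra_simps del: hermite_rec.simps)
  finally show ?case .
qed

lemma poly_hermite_rec_Suc:
  "poly (hermite_rec (Suc n)) x =
     2 * x * poly (hermite_rec n) x - poly (pderiv (hermite_rec n)) x"
  by simp

lemma poly_hermite_rec_Suc_Suc:
  "poly (hermite_rec (Suc (Suc n))) x =
     2 * x * poly (hermite_rec (Suc n)) x - 2 * real (Suc n) * poly (hermite_rec n) x"
  by (simp only: poly_hermite_rec_Suc[of "Suc n"] pderiv_hermite_rec_Suc poly_smult)

lemma hermite_ode:
  "poly (pderiv (pderiv (hermite_rec n))) x =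
     2 * x * poly (pderiv (hermite_rec n)) x - 2 * real n * poly (hermite_rec n) x"
proof -
  have "poly (pderiv (hermite_rec (Suc n))) x = 2 * real (Suc n) * poly (hermite_rec n) x"
    by (simp only: pderiv_hermite_rec_Suc poly_smult)
  moreover have "poly (pderiv (hermite_rec (Suc n))) x =
      2 * poly (hermite_rec n) x + 2 * x * poly (pderiv (hermite_rec n)) x
        - poly (pderiv (pderiv (hermite_rec n))) x"
    by (simp add: pderiv_mult pderiv_diff pderiv_pCons pderiv_smult algebra_simps)
  ultimately show ?thesis by (simp add: algebra_simps)
qed

definition hermite_sqnorm :: "nat \<Rightarrow> real" where
  "hermite_sqnorm n = 2 ^ n * fact n * sqrt pi"

definition hermite_density :: "nat \<Rightarrow> real \<Rightarrow> real" where
  "hermite_density n x = (poly (hermite_rec n) x)\<^sup>2 / hermite_sqnorm n"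

lemma hermite_sqnorm_pos: "hermite_sqnorm n > 0"
  by (simp add: hermite_sqnorm_def)

lemma hermite_sqnorm_Suc: "hermite_sqnorm (Suc n) = 2 * real (Suc n) * hermite_sqnorm n"
  by (simp add: hermite_sqnorm_def algebra_simps)

lemma hermite_density_nonneg: "hermite_density n x \<ge> 0"
  using hermite_sqnorm_pos[of n] by (simp add: hermite_density_def)

section \<open>The energy of a Hermite function\<close>

text \<open>
  For \<open>u = exp (-x\<^sup>2/2) H\<^sub>n\<close> this is \<open>u'\<^sup>2 + (2n + 1 - x\<^sup>2) u\<^sup>2\<close>, the energy of an oscillator with
  slowly varying frequency.
\<close>

definition hermite_energy :: "nat \<Rightarrow> real \<Rightarrow> real" where
  "hermite_energy n x = exp (- x\<^sup>2) *
     ((poly (pderiv (hermite_rec n)) x - x * poly (hermite_rec n) x)\<^sup>2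
       + (2 * real n + 1 - x\<^sup>2) * (poly (hermite_rec n) x)\<^sup>2)"

text \<open>
  The equation \<open>u'' + (2n + 1 - x\<^sup>2) u = 0\<close> cancels everything except the contribution of the
  derivative of the coefficient \<open>2n + 1 - x\<^sup>2\<close>.
\<close>

lemma DERIV_hermite_energy:
  "(hermite_energy n has_real_derivative
      - 2 * x * (exp (- x\<^sup>2) * (poly (hermite_rec n) x)\<^sup>2)) (at x)"
  unfolding hermite_energy_def
  by ((rule derivative_eq_intros poly_DERIV refl)+, simp only: hermite_ode)
     (simp add: algebra_simps power2_eq_square)

text \<open>
  Moving from \<open>0\<close> to \<open>x\<close> along \<open>t x\<close> with \<open>0 \<le> t \<le> 1\<close> treats both signs of \<open>x\<close> at once.
\<close>

lemma hermite_energy_scaled_deriv: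
  "((\<lambda>t. hermite_energy n (t * x)) has_real_derivative
      - 2 * t * x\<^sup>2 * (exp (- (t * x)\<^sup>2) * (poly (hermite_rec n) (t * x))\<^sup>2)) (at t)"
proof -
  have "((\<lambda>t. hermite_energy n (t * x)) has_real_derivative
      (- 2 * (t * x) * (exp (- (t * x)\<^sup>2) * (poly (hermite_rec n) (t * x))\<^sup>2)) * x) (at t)"
    by (rule DERIV_chain2[OF DERIV_hermite_energy]) (auto intro!: derivative_eq_intros)
  then show ?thesis by (simp add: algebra_simps power2_eq_square[of x])
qed

lemma hermite_energy_le_0: "hermite_energy n x \<le> hermite_energy n 0"
proof -
  have "hermite_energy n (1 * x) \<le> hermite_energy n (0 * x)"
    by (rule DERIV_nonpos_imp_nonincreasing[of 0 1 "\<lambda>t. hermite_energy n (t * x)"])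
       (use hermite_energy_scaled_deriv[of n x] in \<open>auto intro!: exI\<close>)
  then show ?thesis by simp
qed

lemma sq_le_hermite_energy:
  "(2 * real n + 1 - x\<^sup>2) * (exp (- x\<^sup>2) * (poly (hermite_rec n) x)\<^sup>2) \<le> hermite_energy n x"
  by (simp add: hermite_energy_def algebra_simps)

text \<open>
  A Gronwall argument: along \<open>t x\<close> the energy decays at a rate at most \<open>2 t \<delta>\<close> times itself,
  where \<open>\<delta> = x\<^sup>2 / (2n + 1 - x\<^sup>2)\<close>, because \<open>(2n + 1 - x\<^sup>2) u\<^sup>2\<close> is one of its two nonnegative parts.
  So the energy times \<open>exp (t\<^sup>2 \<delta>)\<close> is nondecreasing in \<open>t\<close>.
\<close>

lemma hermite_energy_ge_0:
  assumes "x\<^sup>2 < 2 * real n + 1"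
  shows "hermite_energy n 0 \<le> hermite_energy n x * exp (x\<^sup>2 / (2 * real n + 1 - x\<^sup>2))"
proof -
  define \<delta> where "\<delta> = x\<^sup>2 / (2 * real n + 1 - x\<^sup>2)"
  define G where "G = (\<lambda>t. hermite_energy n (t * x) * exp (t\<^sup>2 * \<delta>))"
  have pos: "2 * real n + 1 - x\<^sup>2 > 0" using assms by simp
  have mono: "\<exists>d. DERIV G t :> d \<and> d \<ge> 0" if t: "0 \<le> t" "t \<le> 1" for t
  proof -
    define A where "A = exp (- (t * x)\<^sup>2) * (poly (hermite_rec n) (t * x))\<^sup>2"
    have A0: "A \<ge> 0" by (simp add: A_def)
    have "(t * x)\<^sup>2 \<le> x\<^sup>2"
      using t mult_right_mono[of "t\<^sup>2" 1 "x\<^sup>2"] by (simp add: power_mult_distrib power_le_one)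
    then have "(2 * real n + 1 - x\<^sup>2) * A \<le> (2 * real n + 1 - (t * x)\<^sup>2) * A"
      using A0 by (intro mult_right_mono) auto
    also have "\<dots> \<le> hermite_energy n (t * x)"
      unfolding A_def by (rule sq_le_hermite_energy)
    finally have "\<delta> * ((2 * real n + 1 - x\<^sup>2) * A) \<le> \<delta> * hermite_energy n (t * x)"
      using pos by (intro mult_left_mono) (auto simp: \<delta>_def)
    then have "x\<^sup>2 * A \<le> \<delta> * hermite_energy n (t * x)"
      using pos by (simp add: \<delta>_def)
    then have nonneg: "0 \<le> 2 * t * (\<delta> * hermite_energy n (t * x) - x\<^sup>2 * A) * exp (t\<^sup>2 * \<delta>)"
      using t by simp
    have "DERIV G t :> 2 * t * (\<delta> * hermite_energy n (t * x) - x\<^sup>2 * A) * exp (t\<^sup>2 * \<delta>)"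
      unfolding G_def A_def
      by (rule derivative_eq_intros hermite_energy_scaled_deriv refl)+
         (simp add: algebra_simps power2_eq_square)
    with nonneg show ?thesis by blast
  qed
  have "G 0 \<le> G 1"
    by (rule DERIV_nonneg_imp_nondecreasing[OF _ mono]) simp_all
  then show ?thesis by (simp add: G_def \<delta>_def)
qed

lemma hermite_sqnorm_Suc_cancel:
  "(2 * real (Suc n) * y)\<^sup>2 / hermite_sqnorm (Suc n)
     = 2 * real (Suc n) * (y\<^sup>2 / hermite_sqnorm n)"
  using hermite_sqnorm_pos[of n] unfolding hermite_sqnorm_Suc
  by (simp add: field_simps power2_eq_square del: of_nat_Suc)

text \<open>
  With \<open>p\<close> and \<open>h\<close> the values of \<open>H\<^sub>n\<^sub>+\<^sub>1' - x H\<^sub>n\<^sub>+\<^sub>1\<close> and \<open>H\<^sub>n\<^sub>+\<^sub>1\<close> after normalisation, \<open>A = p\<^sup>2 + d h\<^sup>2\<close>,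
  and \<open>H\<^sub>n\<^sub>+\<^sub>1' = 2(n+1) H\<^sub>n\<close> turns \<open>2(n+1) w\<^sub>n\<close> into \<open>(p + x h)\<^sup>2\<close>. What is left over consists of \<open>p h\<close>
  and \<open>h\<^sup>2\<close>, which are at most \<open>A / \<surd>d\<close> and \<open>A / d\<close>, small relative to \<open>A\<close> as \<open>d\<close> grows with \<open>n\<close>.
\<close>

lemma hermite_pair_near_energy:
  fixes x :: real and n :: nat
  defines "d \<equiv> 2 * real n + 3 - x\<^sup>2"
  defines "A \<equiv> exp (x\<^sup>2) * (hermite_energy (Suc n) x / hermite_sqnorm (Suc n))"
  assumes d: "d > 0"
  shows "\<bar>2 * real (Suc n) * (hermite_density n x + hermite_density (Suc n) x) - A\<bar>
           \<le> A * (2 * \<bar>x\<bar> / sqrt d + \<bar>2 * x\<^sup>2 - 1\<bar> / d)"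
proof -
  define c where "c = hermite_sqnorm (Suc n)"
  define h where "h = poly (hermite_rec (Suc n)) x / sqrt c"
  define p where "p = (poly (pderiv (hermite_rec (Suc n))) x - x * poly (hermite_rec (Suc n)) x) / sqrt c"
  have c: "c > 0" by (simp add: c_def hermite_sqnorm_pos)
  have h2: "h\<^sup>2 = hermite_density (Suc n) x"
    using c by (simp add: h_def power_divide hermite_density_def c_def)
  have A: "A = p\<^sup>2 + d * h\<^sup>2"
  proof -
    have cancel: "exp (x\<^sup>2) * (exp (- x\<^sup>2) * y / c) = y / c" for y
      by (simp add: exp_minus)
    have d': "2 * real (Suc n) + 1 - x\<^sup>2 = d"
      by (simp add: d_def)
    show ?thesis
      unfolding A_def hermite_energy_def c_def[symmetric] cancel d' p_def h_def
      using c by (simp add: power_divide add_divide_distrib del: hermite_rec.simps)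
  qed
  have "p + x * h = poly (pderiv (hermite_rec (Suc n))) x / sqrt c"
    unfolding p_def h_def by (simp add: diff_divide_distrib del: hermite_rec.simps)
  also have "\<dots> = 2 * real (Suc n) * poly (hermite_rec n) x / sqrt c"
    by (simp only: pderiv_hermite_rec_Suc poly_smult)
  finally have "(p + x * h)\<^sup>2 = (2 * real (Suc n) * poly (hermite_rec n) x)\<^sup>2 / c"
    using c by (simp add: power_divide)
  also have "\<dots> = 2 * real (Suc n) * hermite_density n x"
    unfolding c_def hermite_density_def by (rule hermite_sqnorm_Suc_cancel)
  finally have eq: "2 * real (Suc n) * (hermite_density n x + hermite_density (Suc n) x) - A
      = 2 * x * (p * h) + (2 * x\<^sup>2 - 1) * h\<^sup>2"
    unfolding A h2[symmetric] d_def by (simp add: algebra_simps power2_eq_square)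
  have h2_le: "h\<^sup>2 \<le> A / d"
    using d by (simp add: A field_simps)
  (* both p^2 and d h^2 are at most A *)
  have "p\<^sup>2 * (d * h\<^sup>2) \<le> A * A"
    unfolding A using d by (intro mult_mono) auto
  then have "(p * h)\<^sup>2 \<le> (A / sqrt d)\<^sup>2"
    using d by (simp add: field_simps power2_eq_square)
  moreover have "A \<ge> 0" using A d by simp
  ultimately have ph_le: "\<bar>p * h\<bar> \<le> A / sqrt d"
    using d by (metis abs_le_square_iff abs_of_nonneg divide_nonneg_nonneg real_sqrt_ge_zero less_imp_le)
  have "\<bar>2 * x * (p * h) + (2 * x\<^sup>2 - 1) * h\<^sup>2\<bar>
          \<le> 2 * \<bar>x\<bar> * \<bar>p * h\<bar> + \<bar>2 * x\<^sup>2 - 1\<bar> * h\<^sup>2"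
    by (rule order.trans[OF abs_triangle_ineq]) (simp add: abs_mult)
  also have "\<dots> \<le> 2 * \<bar>x\<bar> * (A / sqrt d) + \<bar>2 * x\<^sup>2 - 1\<bar> * (A / d)"
    by (intro add_mono mult_left_mono ph_le h2_le) auto
  finally show ?thesis
    unfolding eq by (simp add: algebra_simps)
qed

lemma hermite_density_0_Suc_Suc:
  "hermite_density (Suc (Suc n)) 0 = (real n + 1) / (real n + 2) * hermite_density n 0"
  using hermite_sqnorm_pos[of n]
  unfolding hermite_density_def poly_hermite_rec_Suc_Suc hermite_sqnorm_Suc
  by (simp add: divide_simps power2_eq_square) (simp add: algebra_simps)

lemma hermite_density_0_odd: "hermite_density (2 * m + 1) 0 = 0"
  by (induction m)
     (simp add: hermite_density_def, simp add: hermite_density_0_Suc_Suc del: hermite_rec.simps)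

text \<open>
  \<open>H\<^sub>2\<^sub>m(0)\<^sup>2 / c\<^sub>2\<^sub>m\<close> is \<open>1/\<surd>\<pi>\<close> times the product of \<open>(2k-1)/(2k)\<close> over \<open>1 \<le> k \<le> m\<close>; its square, multiplied
  by \<open>2m + 1\<close>, regroups into the reciprocal of the Wallis product.
\<close>

lemma hermite_density_0_even_wallis:
  "pi * (2 * real m + 1) * (hermite_density (2 * m) 0)\<^sup>2
     = inverse (\<Prod>k=1..m. (4 * real k ^ 2) / (4 * real k ^ 2 - 1))"
proof (induction m)
  case 0
  show ?case by (simp add: hermite_density_def hermite_sqnorm_def power_divide)
next
  case (Suc m)
  have "hermite_density (2 * Suc m) 0 = (2 * real m + 1) / (2 * real m + 2) * hermite_density (2 * m) 0"
    using hermite_density_0_Suc_Suc[of "2 * m"] by simp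
  then have step: "pi * (2 * real (Suc m) + 1) * (hermite_density (2 * Suc m) 0)\<^sup>2
      = (2 * real m + 3) * (2 * real m + 1) / (2 * real m + 2)\<^sup>2
          * (pi * (2 * real m + 1) * (hermite_density (2 * m) 0)\<^sup>2)"
    by (simp add: power_mult_distrib power_divide power2_eq_square)
  have factor: "inverse ((4 * real (Suc m) ^ 2) / (4 * real (Suc m) ^ 2 - 1))
      = (2 * real m + 3) * (2 * real m + 1) / (2 * real m + 2)\<^sup>2"
    by (simp add: power2_eq_square algebra_simps)
  have prod: "(\<Prod>k=1..Suc m. (4 * real k ^ 2) / (4 * real k ^ 2 - 1))
      = (\<Prod>k=1..m. (4 * real k ^ 2) / (4 * real k ^ 2 - 1))
          * ((4 * real (Suc m) ^ 2) / (4 * real (Suc m) ^ 2 - 1))"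
    by (subst prod.cl_ivl_Suc) (rule if_not_P, simp)
  show ?case
    unfolding step Suc.IH prod inverse_mult_distrib factor by (rule mult.commute)
qed

lemma hermite_density_0_even_asymp:
  "(\<lambda>m. sqrt (2 * real m + 1) * hermite_density (2 * m) 0) \<longlonglongrightarrow> sqrt 2 / pi"
proof -
  have "(\<lambda>m. sqrt (inverse (\<Prod>k=1..m. (4 * real k ^ 2) / (4 * real k ^ 2 - 1)) / pi))
          \<longlonglongrightarrow> sqrt (inverse (pi / 2) / pi)"
    by (intro tendsto_intros wallis) auto
  also have "(\<lambda>m. sqrt (inverse (\<Prod>k=1..m. (4 * real k ^ 2) / (4 * real k ^ 2 - 1)) / pi))
      = (\<lambda>m. sqrt (2 * real m + 1) * hermite_density (2 * m) 0)"
    by (simp only: hermite_density_0_even_wallis[symmetric])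
       (simp add: real_sqrt_mult hermite_density_nonneg)
  also have "sqrt (inverse (pi / 2) / pi) = sqrt 2 / pi"
    by (simp add: real_sqrt_divide)
  finally show ?thesis .
qed

text \<open>
  At \<open>0\<close> the odd terms vanish, so the sum over two neighbours is always the value at the even
  one, and the two parities of \<open>n\<close> yield the same limit.
\<close>

lemma hermite_pair_0_asymp:
  "(\<lambda>n. sqrt (real (Suc n)) * (hermite_density n 0 + hermite_density (Suc n) 0)) \<longlonglongrightarrow> sqrt 2 / pi"
proof (rule limseq_even_odd)
  show "(\<lambda>m. sqrt (real (Suc (2 * m))) * (hermite_density (2 * m) 0 + hermite_density (Suc (2 * m)) 0))
          \<longlonglongrightarrow> sqrt 2 / pi"
    using hermite_density_0_even_asymp hermite_density_0_odd by (simp add: add.commute)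
next
  have "(\<lambda>m. sqrt (2 * real m + 2) / sqrt (2 * real m + 3)) \<longlonglongrightarrow> 1"
    by real_asymp
  from tendsto_mult[OF this LIMSEQ_Suc[OF hermite_density_0_even_asymp]]
  have "(\<lambda>m. sqrt (2 * real m + 2) * hermite_density (2 * Suc m) 0) \<longlonglongrightarrow> sqrt 2 / pi"
    by (simp add: add.commute)
  then show "(\<lambda>m. sqrt (real (Suc (2 * m + 1)))
          * (hermite_density (2 * m + 1) 0 + hermite_density (Suc (2 * m + 1)) 0))
      \<longlonglongrightarrow> sqrt 2 / pi"
    unfolding hermite_density_0_odd by (simp add: add.commute)
qed

lemma hermite_energy_0:
  "hermite_energy (Suc n) 0 / hermite_sqnorm (Suc n)
     = 2 * real (Suc n) * (hermite_density n 0 + hermite_density (Suc n) 0)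
         + hermite_density (Suc n) 0"
proof -
  have "hermite_energy (Suc n) 0 = (2 * real (Suc n) * poly (hermite_rec n) 0)\<^sup>2
          + (2 * real (Suc n) + 1) * (poly (hermite_rec (Suc n)) 0)\<^sup>2"
    by (simp add: hermite_energy_def pderiv_hermite_rec_Suc del: hermite_rec.simps)
  moreover have "(2 * real (Suc n) * poly (hermite_rec n) 0)\<^sup>2 / hermite_sqnorm (Suc n)
      = 2 * real (Suc n) * hermite_density n 0"
    unfolding hermite_density_def by (rule hermite_sqnorm_Suc_cancel)
  ultimately show ?thesis
    by (simp add: hermite_density_def add_divide_distrib distrib_left distrib_right del: hermite_rec.simps)
qed

lemma hermite_energy_0_asymp:
  "(\<lambda>n. hermite_energy (Suc n) 0 / hermite_sqnorm (Suc n) / sqrt (real (Suc n)))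
     \<longlonglongrightarrow> 2 * sqrt 2 / pi"
proof -
  define v where "v = (\<lambda>n. sqrt (real (Suc n)) * (hermite_density n 0 + hermite_density (Suc n) 0))"
  have v: "v \<longlonglongrightarrow> sqrt 2 / pi"
    unfolding v_def by (rule hermite_pair_0_asymp)
  have "(\<lambda>n. 1 / real (Suc n)) \<longlonglongrightarrow> 0" by real_asymp
  from tendsto_mult[OF this v] have v0: "(\<lambda>n. 1 / real (Suc n) * v n) \<longlonglongrightarrow> 0" by simp
  have "(\<lambda>n. hermite_density (Suc n) 0 / sqrt (real (Suc n))) \<longlonglongrightarrow> 0"
  proof (rule Lim_null_comparison[OF _ v0], intro always_eventually allI)
    fix n
    have "hermite_density (Suc n) 0 / sqrt (real (Suc n))
        \<le> (hermite_density n 0 + hermite_density (Suc n) 0) / sqrt (real (Suc n))"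
      by (intro divide_right_mono) (simp_all add: hermite_density_nonneg)
    also have "\<dots> = 1 / real (Suc n) * v n"
      by (simp add: v_def field_simps del: of_nat_Suc)
    finally show "norm (hermite_density (Suc n) 0 / sqrt (real (Suc n))) \<le> 1 / real (Suc n) * v n"
      by (simp add: hermite_density_nonneg)
  qed
  from tendsto_add[OF tendsto_mult[OF tendsto_const[of 2] v] this]
  have "(\<lambda>n. 2 * v n + hermite_density (Suc n) 0 / sqrt (real (Suc n))) \<longlonglongrightarrow> 2 * sqrt 2 / pi"
    by simp
  also have "(\<lambda>n. 2 * v n + hermite_density (Suc n) 0 / sqrt (real (Suc n)))
      = (\<lambda>n. hermite_energy (Suc n) 0 / hermite_sqnorm (Suc n) / sqrt (real (Suc n)))"
  proof
    fix n
    have "2 * real (Suc n) * u / sqrt (real (Suc n)) = 2 * (sqrt (real (Suc n)) * u)" for u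
    proof -
      have "2 * real (Suc n) * u / sqrt (real (Suc n)) = 2 * (real (Suc n) / sqrt (real (Suc n)) * u)"
        by simp
      then show ?thesis by (simp only: real_div_sqrt of_nat_0_le_iff)
    qed
    then show "2 * v n + hermite_density (Suc n) 0 / sqrt (real (Suc n))
        = hermite_energy (Suc n) 0 / hermite_sqnorm (Suc n) / sqrt (real (Suc n))"
      unfolding hermite_energy_0 v_def by (simp only: add_divide_distrib)
  qed
  finally show ?thesis .
qed

text \<open>
  For large \<open>n\<close>, the energy at \<open>x\<close> is squeezed between the energy at \<open>0\<close> and \<open>exp (- \<delta> n)\<close> times that energy, with
  \<open>\<delta> n \<longlonglongrightarrow> 0\<close>.
\<close>

lemma hermite_energy_asymp:
  "(\<lambda>n. hermite_energy (Suc n) x / hermite_sqnorm (Suc n) / sqrt (real (Suc n)))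
     \<longlonglongrightarrow> 2 * sqrt 2 / pi"
proof -
  define E where "E = (\<lambda>n y. hermite_energy (Suc n) y / hermite_sqnorm (Suc n) / sqrt (real (Suc n)))"
  define \<delta> where "\<delta> = (\<lambda>n. x\<^sup>2 / (2 * real (Suc n) + 1 - x\<^sup>2))"
  have E0: "(\<lambda>n. E n 0) \<longlonglongrightarrow> 2 * sqrt 2 / pi"
    unfolding E_def by (rule hermite_energy_0_asymp)
  have "\<delta> \<longlonglongrightarrow> 0" unfolding \<delta>_def by real_asymp
  then have "(\<lambda>n. E n 0 * exp (- \<delta> n)) \<longlonglongrightarrow> 2 * sqrt 2 / pi * exp (- 0)"
    by (intro tendsto_intros E0)
  then have lower: "(\<lambda>n. E n 0 * exp (- \<delta> n)) \<longlonglongrightarrow> 2 * sqrt 2 / pi" by simp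
  have "\<forall>\<^sub>F n in sequentially. x\<^sup>2 < 2 * real (Suc n) + 1" by real_asymp
  then have "\<forall>\<^sub>F n in sequentially. E n 0 * exp (- \<delta> n) \<le> E n x"
  proof eventually_elim
    case (elim n)
    define K where "K = 1 / hermite_sqnorm (Suc n) / sqrt (real (Suc n))"
    have K: "K \<ge> 0" using hermite_sqnorm_pos[of "Suc n"] by (simp add: K_def)
    have "hermite_energy (Suc n) 0 * exp (- \<delta> n) \<le> hermite_energy (Suc n) x"
      using hermite_energy_ge_0[OF elim] by (simp add: \<delta>_def exp_minus field_simps)
    from mult_left_mono[OF this K] show ?case
      by (simp add: E_def K_def mult_ac)
  qed
  moreover have "E n x \<le> E n 0" for n
    unfolding E_def using hermite_sqnorm_pos[of "Suc n"]
    by (intro divide_right_mono hermite_energy_le_0) auto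
  ultimately have "(\<lambda>n. E n x) \<longlonglongrightarrow> 2 * sqrt 2 / pi"
    by (intro tendsto_sandwich[OF _ _ lower E0]) auto
  then show ?thesis by (simp only: E_def)
qed

lemma hermite_pair_asymp:
  "(\<lambda>n. sqrt (real (Suc n)) * (hermite_density n x + hermite_density (Suc n) x))
     \<longlonglongrightarrow> exp (x\<^sup>2) * sqrt 2 / pi"
proof -
  define v where "v = (\<lambda>n. sqrt (real (Suc n)) * (hermite_density n x + hermite_density (Suc n) x))"
  define A where "A = (\<lambda>n. exp (x\<^sup>2) * (hermite_energy (Suc n) x / hermite_sqnorm (Suc n)))"
  define r where "r = (\<lambda>n. 2 * \<bar>x\<bar> / sqrt (2 * real n + 3 - x\<^sup>2)
                             + \<bar>2 * x\<^sup>2 - 1\<bar> / (2 * real n + 3 - x\<^sup>2))"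
  have A: "(\<lambda>n. A n / sqrt (real (Suc n))) \<longlonglongrightarrow> exp (x\<^sup>2) * (2 * sqrt 2 / pi)"
    using tendsto_mult[OF tendsto_const hermite_energy_asymp[of x], of "exp (x\<^sup>2)"]
    by (simp add: A_def)
  have "(\<lambda>n. a / sqrt (2 * real n + 3 - x\<^sup>2) + b / (2 * real n + 3 - x\<^sup>2)) \<longlonglongrightarrow> 0" for a b :: real
    by real_asymp
  then have r: "r \<longlonglongrightarrow> 0" unfolding r_def .
  have "\<forall>\<^sub>F n in sequentially. 2 * real n + 3 - x\<^sup>2 > 0" by real_asymp
  then have bound: "\<forall>\<^sub>F n in sequentially. norm (2 * v n - A n / sqrt (real (Suc n))) \<le> A n / sqrt (real (Suc n)) * r n"
  proof eventually_elim
    case (elim n)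
    have "2 * v n - A n / sqrt (real (Suc n))
        = (2 * real (Suc n) * (hermite_density n x + hermite_density (Suc n) x) - A n) / sqrt (real (Suc n))"
      by (simp add: v_def field_simps del: of_nat_Suc)
    moreover have "\<bar>2 * real (Suc n) * (hermite_density n x + hermite_density (Suc n) x) - A n\<bar> \<le> A n * r n"
      using hermite_pair_near_energy[OF elim] by (simp only: A_def r_def)
    ultimately show ?case
      by (simp add: abs_divide divide_right_mono del: of_nat_Suc)
  qed
  have "(\<lambda>n. A n / sqrt (real (Suc n)) * r n) \<longlonglongrightarrow> 0"
    using tendsto_mult[OF A r] by simp
  from tendsto_add[OF Lim_null_comparison[OF bound this] A]
  have "(\<lambda>n. 2 * v n) \<longlonglongrightarrow> exp (x\<^sup>2) * (2 * sqrt 2 / pi)" by simp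
  from tendsto_mult[OF tendsto_const[of "1/2"] this] show ?thesis
    by (simp add: v_def)
qed

section \<open>Tails of series\<close>

text \<open>
  The Stolz--Cesaro theorem for tails: from some index on, \<open>b n\<close> lies within
  \<open>\<epsilon> (c n - c (n+1))\<close> of \<open>l (c n - c (n+1))\<close>, and the differences \<open>c n - c (n+1)\<close> with \<open>n \<ge> N\<close> add up
  to \<open>c N\<close>.
\<close>

lemma tail_sum_asymp:
  fixes b c :: "nat \<Rightarrow> real"
  assumes dec: "\<And>n. c (Suc n) < c n" and c0: "c \<longlonglongrightarrow> 0"
    and lim: "(\<lambda>n. b n / (c n - c (Suc n))) \<longlonglongrightarrow> l"
  shows "summable b" and "(\<lambda>N. (\<Sum>k. b (N + k)) / c N) \<longlonglongrightarrow> l"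
proof -
  define d where "d = (\<lambda>n. c n - c (Suc n))"
  have d: "d n > 0" for n using dec[of n] by (simp add: d_def)
  have c: "c n > 0" for n
    using decseq_ge[OF decseq_SucI c0, of "Suc n"] dec by (meson less_imp_le le_less_trans)
  have d_sums: "(\<lambda>k. d (N + k)) sums c N" for N
    using telescope_sums'[OF LIMSEQ_ignore_initial_segment[OF c0, of N]]
    by (simp add: d_def add.commute)
  have close: "\<exists>M. \<forall>n\<ge>M. \<bar>b n - l * d n\<bar> \<le> \<epsilon> * d n" if "\<epsilon> > 0" for \<epsilon>
  proof -
    from LIMSEQ_D[OF lim that] obtain M where M: "\<And>n. n \<ge> M \<Longrightarrow> \<bar>b n / d n - l\<bar> < \<epsilon>"
      unfolding d_def by auto
    have "\<bar>b n - l * d n\<bar> \<le> \<epsilon> * d n" if "n \<ge> M" for n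
    proof -
      have "\<bar>b n - l * d n\<bar> = \<bar>b n / d n - l\<bar> * d n"
        using d[of n] by (simp add: abs_mult_pos field_simps)
      also have "\<dots> \<le> \<epsilon> * d n"
        using M[OF that] d[of n] by (intro mult_right_mono) auto
      finally show ?thesis .
    qed
    then show ?thesis by blast
  qed
  have d_summable: "summable d" using d_sums[of 0] by (simp add: sums_iff)
  obtain M where M: "\<forall>n\<ge>M. \<bar>b n - l * d n\<bar> \<le> 1 * d n" using close[of 1] by auto
  have "summable (\<lambda>n. b n - l * d n)"
    by (rule summable_comparison_test'[OF d_summable, of M]) (use M in simp)
  from summable_add[OF this summable_mult[OF d_summable, of l]]
  show b_summable: "summable b" by simp
  show "(\<lambda>N. (\<Sum>k. b (N + k)) / c N) \<longlonglongrightarrow> l"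
  proof (rule LIMSEQ_I)
    fix \<epsilon> :: real assume \<epsilon>: "\<epsilon> > 0"
    obtain M where M: "\<And>n. n \<ge> M \<Longrightarrow> \<bar>b n - l * d n\<bar> \<le> \<epsilon> / 2 * d n"
      using close[of "\<epsilon> / 2"] \<epsilon> by auto
    have "norm ((\<Sum>k. b (N + k)) / c N - l) < \<epsilon>" if N: "N \<ge> M" for N
    proof -
      have bN: "summable (\<lambda>k. b (N + k))"
        using summable_ignore_initial_segment[OF b_summable, of N] by (simp add: add.commute)
      have "(\<lambda>k. b (N + k) - l * d (N + k)) sums ((\<Sum>k. b (N + k)) - l * c N)"
        by (intro sums_diff sums_mult d_sums summable_sums bN)
      moreover have "norm (b (N + k) - l * d (N + k)) \<le> \<epsilon> / 2 * d (N + k)" for k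
        using M[of "N + k"] N by simp
      ultimately have "norm ((\<Sum>k. b (N + k)) - l * c N) \<le> \<epsilon> / 2 * c N"
        using norm_suminf_le[of "\<lambda>k. b (N + k) - l * d (N + k)" "\<lambda>k. \<epsilon> / 2 * d (N + k)"]
          sums_mult[OF d_sums[of N], of "\<epsilon> / 2"] by (simp add: sums_iff)
      then have "norm ((\<Sum>k. b (N + k)) - l * c N) / c N \<le> \<epsilon> / 2"
        using c[of N] by (simp only: pos_divide_le_eq)
      moreover have "(\<Sum>k. b (N + k)) / c N - l = ((\<Sum>k. b (N + k)) - l * c N) / c N"
        using c[of N] by (simp add: diff_divide_distrib)
      ultimately have "norm ((\<Sum>k. b (N + k)) / c N - l) \<le> \<epsilon> / 2"
        using c[of N] by simp
      then show ?thesis using \<epsilon> by simp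
    qed
    then show "\<exists>M. \<forall>N\<ge>M. norm ((\<Sum>k. b (N + k)) / c N - l) < \<epsilon>" by blast
  qed
qed

text \<open>
  A sequence may oscillate although the sums of two neighbours behave regularly; its weighted
  tail sums then behave as if each term were half of such a sum. Writing half of the term
  \<open>a (m+1) / (2(m+1))\<close> with a neighbour in place of itself leaves a main part \<open>e m\<close>, to which
  \<open>tail_sum_asymp\<close> applies with \<open>c m = 1 / \<surd>(m+1)\<close>, and a telescoping part \<open>t m - t (m+1)\<close> whose
  tail \<open>t N\<close> is \<open>O(N\<^bsup>-3/2\<^esup>)\<close>.
\<close>

lemma tail_sum_of_averages:
  fixes a :: "nat \<Rightarrow> real"
  assumes nonneg: "\<And>n. a n \<ge> 0"
    and lim: "(\<lambda>n. sqrt (real (Suc n)) * (a n + a (Suc n))) \<longlonglongrightarrow> L"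
  shows "summable (\<lambda>k. a (N + 1 + k) / (2 * real (N + 1 + k)))"
    and "(\<lambda>N. sqrt (real N) * (\<Sum>k. a (N + 1 + k) / (2 * real (N + 1 + k)))) \<longlonglongrightarrow> L / 2"
proof -
  define s where "s = (\<lambda>m. sqrt (real m + 2) * (a (m + 1) + a (m + 2)))"
  define t where "t = (\<lambda>m. a (m + 1) / (4 * (real m + 1)))"
  (* e m is t m + t (m+1), arranged so that the regular sum a (m+1) + a (m+2) appears *)
  define e where "e = (\<lambda>m. (a (m + 1) + a (m + 2)) / (4 * (real m + 1))
                            - a (m + 2) / (4 * (real m + 1) * (real m + 2)))"
  define b where "b = (\<lambda>m. a (m + 1) / (2 * (real m + 1)))"
  define c where "c = (\<lambda>m. 1 / sqrt (real m + 1))"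
  have s: "s \<longlonglongrightarrow> L"
    using LIMSEQ_Suc[OF lim] by (simp add: s_def add.commute)
  have t_bound: "norm (t m) \<le> s m / (4 * (real m + 1) * sqrt (real m + 2))" for m
    using nonneg[of "m + 1"] nonneg[of "m + 2"]
    by (simp add: s_def t_def divide_right_mono)
  have b_split: "b m = e m + (t m - t (Suc m))" for m
  proof -
    have "b m = 2 * t m"
      by (simp add: b_def t_def divide_simps)
    moreover have "e m = t m + a (m + 2) / (4 * (real m + 1))
                       - a (m + 2) / (4 * (real m + 1) * (real m + 2))"
      by (simp only: e_def t_def add_divide_distrib)
    moreover have "a (m + 2) / (4 * (real m + 1)) - a (m + 2) / (4 * (real m + 1) * (real m + 2))
                     = a (m + 2) / (4 * (real m + 2))"
      by (simp add: divide_simps) (simp add: algebra_simps)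
    moreover have "t (Suc m) = a (m + 2) / (4 * (real m + 2))"
      by (simp add: t_def add.commute)
    ultimately show ?thesis by linarith
  qed
  have c: "c (Suc m) < c m" for m
    by (simp add: c_def field_simps)
  have c0: "c \<longlonglongrightarrow> 0" unfolding c_def by real_asymp
  have "(\<lambda>m. e m / (c m - c (Suc m))) \<longlonglongrightarrow> L / 2"
  proof -
    (* the weight relating s m to e m over the difference of c; it tends to 1/2 as
       c m - c (m+1) is asymptotically half of m to the power -3/2 *)
    define u where "u = (\<lambda>m. 1 / (4 * (real m + 1) * sqrt (real m + 2) * (c m - c (Suc m))))"
    have u: "u \<longlonglongrightarrow> 1 / 2" unfolding u_def c_def of_nat_Suc by real_asymp
    have u0: "u m > 0" for m using c[of m] by (simp add: u_def)
    have e: "e m / (c m - c (Suc m)) = s m * u m - sqrt (real m + 2) * a (m + 2) / (real m + 2) * u m" for m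
      unfolding e_def u_def s_def using c[of m] by (simp add: diff_divide_distrib)
    have "(\<lambda>m. 1 / (real m + 2)) \<longlonglongrightarrow> 0" by real_asymp
    from tendsto_mult[OF tendsto_mult[OF s this] u]
    have bound0: "(\<lambda>m. s m * (1 / (real m + 2)) * u m) \<longlonglongrightarrow> 0" by simp
    have "(\<lambda>m. sqrt (real m + 2) * a (m + 2) / (real m + 2) * u m) \<longlonglongrightarrow> 0"
    proof (rule Lim_null_comparison[OF _ bound0], intro always_eventually allI)
      fix m
      have "sqrt (real m + 2) * a (m + 2) \<le> s m"
        unfolding s_def using nonneg[of "m + 1"] by (intro mult_left_mono) auto
      then have "sqrt (real m + 2) * a (m + 2) / (real m + 2) * u m \<le> s m / (real m + 2) * u m"
        using u0[of m] by (intro mult_right_mono divide_right_mono) auto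
      then show "norm (sqrt (real m + 2) * a (m + 2) / (real m + 2) * u m)
                   \<le> s m * (1 / (real m + 2)) * u m"
        using nonneg[of "m + 2"] u0[of m] by simp
    qed
    from tendsto_diff[OF tendsto_mult[OF s u] this] show ?thesis
      by (simp add: e)
  qed
  note e = tail_sum_asymp[OF c c0 this]
  have "(\<lambda>m. 1 / (4 * (real m + 1) * sqrt (real m + 2))) \<longlonglongrightarrow> 0" by real_asymp
  from tendsto_mult[OF s this]
  have t_bound0: "(\<lambda>m. s m / (4 * (real m + 1) * sqrt (real m + 2))) \<longlonglongrightarrow> 0" by simp
  have t0: "t \<longlonglongrightarrow> 0"
    by (rule Lim_null_comparison[OF _ t_bound0]) (intro always_eventually allI t_bound)
  have b_sums: "(\<lambda>k. b (N + k)) sums ((\<Sum>k. e (N + k)) + t N)" for N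
  proof -
    have "(\<lambda>k. t (N + k) - t (Suc (N + k))) sums (t N - 0)"
      using telescope_sums'[OF LIMSEQ_ignore_initial_segment[OF t0, of N]]
      by (simp add: add.commute)
    moreover have "summable (\<lambda>k. e (N + k))"
      using summable_ignore_initial_segment[OF e(1), of N] by (simp add: add.commute)
    ultimately show ?thesis
      unfolding b_split by (auto intro: sums_add summable_sums)
  qed
  have b: "a (N + 1 + k) / (2 * real (N + 1 + k)) = b (N + k)" for N k
    by (simp add: b_def add_ac)
  show "summable (\<lambda>k. a (N + 1 + k) / (2 * real (N + 1 + k)))"
    unfolding b using b_sums[of N] by (simp add: sums_iff)
  have "(\<lambda>N. sqrt (real N) / sqrt (real N + 1)) \<longlonglongrightarrow> 1" by real_asymp
  from tendsto_mult[OF this e(2)]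
  have e_lim: "(\<lambda>N. sqrt (real N) * (\<Sum>k. e (N + k))) \<longlonglongrightarrow> L / 2"
    by (simp add: c_def field_simps)
  have "(\<lambda>m. sqrt (real m) * (1 / (4 * (real m + 1) * sqrt (real m + 2)))) \<longlonglongrightarrow> 0" by real_asymp
  from tendsto_mult[OF s this]
  have st_bound0: "(\<lambda>m. sqrt (real m) * (s m / (4 * (real m + 1) * sqrt (real m + 2)))) \<longlonglongrightarrow> 0"
    by (simp add: mult_ac)
  have "(\<lambda>N. sqrt (real N) * t N) \<longlonglongrightarrow> 0"
  proof (rule Lim_null_comparison[OF _ st_bound0], intro always_eventually allI)
    fix N
    show "norm (sqrt (real N) * t N)
        \<le> sqrt (real N) * (s N / (4 * (real N + 1) * sqrt (real N + 2)))"
      using mult_left_mono[OF t_bound[of N], of "sqrt (real N)"] by (simp add: abs_mult)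
  qed
  from tendsto_add[OF e_lim this] show
    "(\<lambda>N. sqrt (real N) * (\<Sum>k. a (N + 1 + k) / (2 * real (N + 1 + k)))) \<longlonglongrightarrow> L / 2"
    unfolding b using b_sums by (simp add: sums_iff distrib_left)
qed

text \<open>
  Summation by parts. With \<open>c k = 1 / (2(N+k+1))\<close> the general term is the difference of
  \<open>q k = Q (N+k) c k\<close> plus \<open>r k\<close>, a value of \<open>Q\<close> times \<open>c k - c (k+1)\<close>. The boundary term and the sum of
  the \<open>r k\<close> are each at most \<open>B c 0 = B / (2(N+1))\<close>.
\<close>

lemma tail_sum_bounded_differences:
  fixes Q :: "nat \<Rightarrow> real"
  assumes Q: "\<And>n. \<bar>Q n\<bar> \<le> B"
  shows "summable (\<lambda>k. (Q (N + 1 + k) - Q (N + k)) / (2 * real (N + 1 + k)))"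
    and "\<bar>\<Sum>k. (Q (N + 1 + k) - Q (N + k)) / (2 * real (N + 1 + k))\<bar> \<le> B / (real N + 1)"
proof -
  define q where "q = (\<lambda>k. Q (N + k) / (2 * (real (N + k) + 1)))"
  define c where "c = (\<lambda>k. 1 / (2 * (real (N + k) + 1)))"
  have c0: "c \<longlonglongrightarrow> 0" unfolding c_def of_nat_add by real_asymp
  have q_bound: "norm (q k) \<le> B * c k" for k
    using Q[of "N + k"] by (simp add: q_def c_def divide_right_mono)
  have q0: "q \<longlonglongrightarrow> 0"
    by (rule Lim_null_comparison[OF _ tendsto_mult_right_zero[OF c0, of B]])
       (use q_bound in \<open>auto\<close>)
  define r where "r = (\<lambda>k. Q (N + 1 + k) * (c k - c (Suc k)))"
  have by_parts: "(Q (N + 1 + k) - Q (N + k)) / (2 * real (N + 1 + k)) = (q (Suc k) - q k) + r k" for k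
    by (simp add: q_def r_def c_def right_diff_distrib diff_divide_distrib add_ac)
  have c_sums: "(\<lambda>k. B * (c k - c (Suc k))) sums (B * c 0)"
    using sums_mult[OF telescope_sums'[OF c0], of B] by simp
  have r_bound: "norm (r k) \<le> B * (c k - c (Suc k))" for k
  proof -
    have "c (Suc k) \<le> c k" by (simp add: c_def field_simps)
    then show ?thesis
      using Q[of "N + 1 + k"] by (simp add: r_def abs_mult mult_right_mono)
  qed
  have r_summable: "summable r"
    by (rule summable_comparison_test'[OF sums_summable[OF c_sums]]) (rule r_bound)
  have r_sum: "norm (suminf r) \<le> B * c 0"
    using norm_suminf_le[OF r_bound sums_summable[OF c_sums]] c_sums by (simp add: sums_iff)
  have sums: "(\<lambda>k. (Q (N + 1 + k) - Q (N + k)) / (2 * real (N + 1 + k))) sums (0 - q 0 + suminf r)"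
    unfolding by_parts by (intro sums_add telescope_sums q0 summable_sums r_summable)
  then show "summable (\<lambda>k. (Q (N + 1 + k) - Q (N + k)) / (2 * real (N + 1 + k)))"
    by (rule sums_summable)
  have "\<bar>0 - q 0 + suminf r\<bar> \<le> 2 * (B * c 0)"
    using q_bound[of 0] r_sum by (simp add: abs_le_iff)
  also have "2 * (B * c 0) = B / (real N + 1)" by (simp add: c_def divide_simps)
  finally show "\<bar>\<Sum>k. (Q (N + 1 + k) - Q (N + k)) / (2 * real (N + 1 + k))\<bar> \<le> B / (real N + 1)"
    using sums by (simp add: sums_iff)
qed

section \<open>The Christoffel--Darboux bracket\<close>

text \<open>
  This is \<open>x - y\<close> times the reproducing kernel \<open>H\<^sub>0(x) H\<^sub>0(y)/c\<^sub>0 + \<dots> + H\<^sub>n(x) H\<^sub>n(y)/c\<^sub>n\<close>.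
\<close>

definition christoffel_darboux :: "real \<Rightarrow> real \<Rightarrow> nat \<Rightarrow> real" where
  "christoffel_darboux x y n =
     (poly (hermite_rec (Suc n)) x * poly (hermite_rec n) y
       - poly (hermite_rec n) x * poly (hermite_rec (Suc n)) y) / (2 * hermite_sqnorm n)"

lemma christoffel_darboux_Suc:
  "christoffel_darboux x y (Suc n) - christoffel_darboux x y n
     = (x - y) * (poly (hermite_rec (Suc n)) x * poly (hermite_rec (Suc n)) y / hermite_sqnorm (Suc n))"
proof -
  define K where "K = real (Suc n)"
  have K: "K > 0" by (simp add: K_def)
  show ?thesis
    using hermite_sqnorm_pos[of n] K
    unfolding christoffel_darboux_def poly_hermite_rec_Suc_Suc hermite_sqnorm_Suc K_def[symmetric]
    by (simp add: divide_simps del: hermite_rec.simps) (simp add: algebra_simps del: hermite_rec.simps)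
qed

lemma hermite_density_bounded:
  "\<exists>B. \<forall>n. sqrt (real (Suc n)) * hermite_density n x \<le> B
         \<and> sqrt (real (Suc n)) * hermite_density (Suc n) x \<le> B"
proof -
  obtain B where B: "\<And>n. norm (sqrt (real (Suc n)) * (hermite_density n x + hermite_density (Suc n) x)) \<le> B"
    using convergent_imp_Bseq[OF convergentI[OF hermite_pair_asymp[of x]]] unfolding Bseq_def by blast
  have "sqrt (real (Suc n)) * hermite_density n x \<le> B
         \<and> sqrt (real (Suc n)) * hermite_density (Suc n) x \<le> B" for n
  proof -
    have "0 \<le> sqrt (real (Suc n)) * hermite_density n x"
      and "0 \<le> sqrt (real (Suc n)) * hermite_density (Suc n) x"
      by (simp_all add: hermite_density_nonneg)
    then show ?thesis
      using B[of n] unfolding real_norm_def distrib_left by linarith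
  qed
  then show ?thesis by blast
qed

text \<open>
  Since \<open>c\<^sub>n\<^sub>+\<^sub>1 = 2(n+1) c\<^sub>n\<close>, twice the square of the left-hand side equals
  \<open>(n+1) w\<^sub>n\<^sub>+\<^sub>1(u) w\<^sub>n(v)\<close>. The factor \<open>n+1\<close> splits evenly, one \<open>\<surd>(n+1)\<close> for each density, which is
  exactly what the decay \<open>O(n\<^bsup>-1/2\<^esup>)\<close> of the densities can absorb.
\<close>

lemma hermite_Suc_mult_le:
  assumes u: "sqrt (real (Suc n)) * hermite_density (Suc n) u \<le> B"
    and v: "sqrt (real (Suc n)) * hermite_density n v \<le> B"
  shows "\<bar>poly (hermite_rec (Suc n)) u * poly (hermite_rec n) v / (2 * hermite_sqnorm n)\<bar> \<le> B"
proof -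
  let ?U = "poly (hermite_rec (Suc n)) u" and ?V = "poly (hermite_rec n) v"
  define c where "c = hermite_sqnorm n"
  have c: "c > 0" by (simp add: c_def hermite_sqnorm_pos)
  have r: "sqrt (real (Suc n)) * sqrt (real (Suc n)) = real (Suc n)" by simp
  have B: "B \<ge> 0"
    using v hermite_density_nonneg[of n v] by (meson mult_nonneg_nonneg order.trans real_sqrt_ge_zero of_nat_0_le_iff)
  have "2 * (?U * ?V / (2 * c))\<^sup>2
      = (sqrt (real (Suc n)) * hermite_density (Suc n) u) * (sqrt (real (Suc n)) * hermite_density n v)"
  proof -
    have "(sqrt (real (Suc n)) * hermite_density (Suc n) u) * (sqrt (real (Suc n)) * hermite_density n v)
        = real (Suc n) * (hermite_density (Suc n) u * hermite_density n v)"
      using r by (metis (no_types, lifting) mult.assoc mult.left_commute)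
    also have "\<dots> = 2 * (?U * ?V / (2 * c))\<^sup>2"
      unfolding hermite_density_def hermite_sqnorm_Suc c_def[symmetric] using c
      by (simp add: power2_eq_square field_simps del: hermite_rec.simps of_nat_Suc)
    finally show ?thesis by simp
  qed
  also have "\<dots> \<le> B * B"
    using B by (intro mult_mono u v) (simp_all add: hermite_density_nonneg)
  finally have "(?U * ?V / (2 * c))\<^sup>2 \<le> B\<^sup>2"
    unfolding power2_eq_square[of B] using zero_le_power2[of "?U * ?V / (2 * c)"] by linarith
  then show ?thesis
    using B unfolding c_def by (metis abs_le_square_iff abs_of_nonneg)
qed

lemma christoffel_darboux_bounded: "\<exists>B. \<forall>n. \<bar>christoffel_darboux x y n\<bar> \<le> B"
proof -
  obtain B where B: "\<And>n. sqrt (real (Suc n)) * hermite_density n x \<le> B"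
      "\<And>n. sqrt (real (Suc n)) * hermite_density (Suc n) x \<le> B"
    using hermite_density_bounded[of x] by blast
  obtain C where C: "\<And>n. sqrt (real (Suc n)) * hermite_density n y \<le> C"
      "\<And>n. sqrt (real (Suc n)) * hermite_density (Suc n) y \<le> C"
    using hermite_density_bounded[of y] by blast
  define M where "M = max B C"
  have "\<bar>christoffel_darboux x y n\<bar> \<le> M + M" for n
  proof -
    have "christoffel_darboux x y n
        = poly (hermite_rec (Suc n)) x * poly (hermite_rec n) y / (2 * hermite_sqnorm n)
          - poly (hermite_rec (Suc n)) y * poly (hermite_rec n) x / (2 * hermite_sqnorm n)"
      by (simp only: christoffel_darboux_def diff_divide_distrib mult.commute)
    moreover have "\<bar>poly (hermite_rec (Suc n)) x * poly (hermite_rec n) y / (2 * hermite_sqnorm n)\<bar> \<le> M"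
      by (rule hermite_Suc_mult_le) (use B(2)[of n] C(1)[of n] in \<open>auto simp: M_def\<close>)
    moreover have "\<bar>poly (hermite_rec (Suc n)) y * poly (hermite_rec n) x / (2 * hermite_sqnorm n)\<bar> \<le> M"
      by (rule hermite_Suc_mult_le) (use C(2)[of n] B(1)[of n] in \<open>auto simp: M_def\<close>)
    ultimately show ?thesis by linarith
  qed
  then show ?thesis by blast
qed

section \<open>The asymptotics of the tails\<close>

lemma hermite_diagonal_tail:
  fixes x :: real
  defines "b \<equiv> \<lambda>n. (poly (hermite_rec n) x)\<^sup>2 / (2 * real n * 2 ^ n * fact n * sqrt pi)"
  shows "summable (\<lambda>k. b (N + 1 + k))"
    and "(\<lambda>N. sqrt (real N) * (\<Sum>k. b (N + 1 + k))) \<longlonglongrightarrow> exp (x\<^sup>2) / (sqrt 2 * pi)"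
proof -
  have b: "b n = hermite_density n x / (2 * real n)" for n
    by (simp add: b_def hermite_density_def hermite_sqnorm_def mult_ac)
  note tail = tail_sum_of_averages[of "\<lambda>n. hermite_density n x",
      OF hermite_density_nonneg hermite_pair_asymp]
  show "summable (\<lambda>k. b (N + 1 + k))" unfolding b by (rule tail(1))
  have "exp (x\<^sup>2) * sqrt 2 / pi / 2 = exp (x\<^sup>2) / (sqrt 2 * pi)"
    by (simp add: field_simps)
  then show "(\<lambda>N. sqrt (real N) * (\<Sum>k. b (N + 1 + k))) \<longlonglongrightarrow> exp (x\<^sup>2) / (sqrt 2 * pi)"
    unfolding b using tail(2) by (simp only:)
qed

text \<open>
  Dividing the Christoffel--Darboux brackets by \<open>x - y\<close> gives a bounded sequence \<open>Q\<close> whose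
  differences are \<open>H\<^sub>n(x) H\<^sub>n(y) / c\<^sub>n\<close>.
\<close>

lemma hermite_off_diagonal_tail:
  fixes x y \<gamma> :: real
  defines "b \<equiv> \<lambda>n. poly (hermite_rec n) x * poly (hermite_rec n) y
                     / (2 * real n * 2 ^ n * fact n * sqrt pi)"
  assumes "x \<noteq> y"
  shows "summable (\<lambda>k. b (N + 1 + k))"
    and "\<gamma> < 1 \<Longrightarrow> (\<lambda>N. real N powr \<gamma> * (\<Sum>k. b (N + 1 + k))) \<longlonglongrightarrow> 0"
proof -
  define Q where "Q = (\<lambda>n. christoffel_darboux x y n / (x - y))"
  obtain B where B: "\<And>n. \<bar>christoffel_darboux x y n\<bar> \<le> B"
    using christoffel_darboux_bounded by blast
  define C where "C = B / \<bar>x - y\<bar>"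
  have Q: "\<bar>Q n\<bar> \<le> C" for n
    unfolding Q_def C_def abs_divide by (intro divide_right_mono B) simp
  have b: "b (N + 1 + k) = (Q (N + 1 + k) - Q (N + k)) / (2 * real (N + 1 + k))" for N k
  proof -
    have "Q (Suc (N + k)) - Q (N + k) = poly (hermite_rec (Suc (N + k))) x
            * poly (hermite_rec (Suc (N + k))) y / hermite_sqnorm (Suc (N + k))"
      using christoffel_darboux_Suc[of x y "N + k"] \<open>x \<noteq> y\<close>
      by (simp add: Q_def del: hermite_rec.simps flip: diff_divide_distrib)
    then show ?thesis
      by (simp add: b_def hermite_sqnorm_def mult_ac del: hermite_rec.simps of_nat_Suc)
  qed
  note tail = tail_sum_bounded_differences[of Q, OF Q]
  show "summable (\<lambda>k. b (N + 1 + k))" unfolding b by (rule tail(1))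
  assume "\<gamma> < 1"
  then have lim: "(\<lambda>N. real N powr \<gamma> * (C / (real N + 1))) \<longlonglongrightarrow> 0"
    by real_asymp
  show "(\<lambda>N. real N powr \<gamma> * (\<Sum>k. b (N + 1 + k))) \<longlonglongrightarrow> 0"
  proof (rule Lim_null_comparison[OF _ lim], intro always_eventually allI)
    fix N
    show "norm (real N powr \<gamma> * (\<Sum>k. b (N + 1 + k))) \<le> real N powr \<gamma> * (C / (real N + 1))"
      unfolding b real_norm_def abs_mult abs_of_nonneg[OF powr_ge_zero]
      using tail(2)[of N] by (intro mult_mono) auto
  qed
qed

theorem theorem1p3:
  fixes H :: "nat \<Rightarrow> real poly"
  assumes "hermite_family H"
  shows "(\<forall>x::real.
            (\<forall>N. summable (\<lambda>k. let n = N + 1 + k in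
               (poly (H n) x)\<^sup>2 / (2 * real n * 2 ^ n * fact n * sqrt pi))) \<and>
            (\<lambda>N. sqrt (real N) * (\<Sum>k. let n = N + 1 + k in
               (poly (H n) x)\<^sup>2 / (2 * real n * 2 ^ n * fact n * sqrt pi)))
              \<longlonglongrightarrow> exp (x\<^sup>2) / (sqrt 2 * pi)) \<and>
         (\<forall>x y::real. x \<noteq> y \<longrightarrow>
            (\<forall>N. summable (\<lambda>k. let n = N + 1 + k in
               poly (H n) x * poly (H n) y / (2 * real n * 2 ^ n * fact n * sqrt pi))) \<and>
            (\<forall>\<gamma>::real. \<gamma> < 1 \<longrightarrow>
              (\<lambda>N. real N powr \<gamma> * (\<Sum>k. let n = N + 1 + k in
                 poly (H n) x * poly (H n) y / (2 * real n * 2 ^ n * fact n * sqrt pi)))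
                \<longlonglongrightarrow> 0))"
proof -
  have "H = hermite_rec"
    using hermite_family_unique[OF assms] by (rule ext)
  then show ?thesis
    unfolding Let_def
    by (intro conjI allI impI)
       (simp_all only: hermite_diagonal_tail hermite_off_diagonal_tail not_False_eq_True)
qed

end
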